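(* Let $\mathbb{Z}[i]\setminus\{0\}$ be equipped with the coprimality topology $\mathcal{T}$. Two elements $x,y\in\mathbb{Z}[i]\setminus\{0\}$ are topologically indistinguishable with respect to $\mathcal{T}$ if and only if $\operatorname{Supp}(x)=\operatorname{Supp}(y)$.
   Context: $\mathbb{Z}[i]$ is the ring of Gaussian integers, with group of units $\{1,-1,i,-i\}$. Two elements $\alpha,\beta\in\mathbb{Z}[i]\setminus\{0\}$ are associates, written $\alpha\sim\beta$, if $\alpha=u\beta$ for some unit $u$; $\gcd(\alpha,\beta)\sim 1$ means that $\alpha$ and $\beta$ are coprime. For $\alpha\in\mathbb{Z}[i]\setminus\{0\}$, the prime support $\operatorname{Supp}(\alpha)$ is the finite set of associate classes of Gaussian primes dividing $\alpha$ (so it is empty if $\alpha$ is a unit). For $\alpha\in\mathbb{Z}[i]\setminus\{0\}$ put $\sigma_\alpha=\{\beta\in\mathbb{Z}[i]\setminus\{0\}:\gcd(\alpha,\beta)\sim 1\}$. The coprimality topology $\mathcal{T}$ on $\mathbb{Z}[i]\setminus\{0\}$ is the topology generated by the collection $\{\sigma_\alpha:\alpha\in\mathbb{Z}[i]\setminus\{0\}\}$. Two points of a topological space are topologically indistinguishable if they belong to exactly the same open sets. *)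

theory Defs
  imports "HOL-Analysis.Abstract_Topology" "HOL-Computational_Algebra.Factorial_Ring"
begin

section \<open>The Gaussian integers\<close>

datatype gauss_int = Gauss (ReZ: int) (ImZ: int)

lemma gauss_int_eq_iff: "x = y \<longleftrightarrow> ReZ x = ReZ y \<and> ImZ x = ImZ y"
  by (cases x; cases y) simp

instantiation gauss_int :: comm_ring_1
begin

definition "0 = Gauss 0 0"
definition "1 = Gauss 1 0"
definition "x + y = Gauss (ReZ x + ReZ y) (ImZ x + ImZ y)"
definition "x - y = Gauss (ReZ x - ReZ y) (ImZ x - ImZ y)"
definition "- x = Gauss (- ReZ x) (- ImZ x)"
definition "x * y = Gauss (ReZ x * ReZ y - ImZ x * ImZ y) (ReZ x * ImZ y + ImZ x * ReZ y)"

lemma gauss_int_sel [simp]: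
  "ReZ 0 = 0" "ImZ 0 = 0" "ReZ 1 = 1" "ImZ 1 = 0"
  "ReZ (x + y) = ReZ x + ReZ y" "ImZ (x + y) = ImZ x + ImZ y"
  "ReZ (x - y) = ReZ x - ReZ y" "ImZ (x - y) = ImZ x - ImZ y"
  "ReZ (- x) = - ReZ x" "ImZ (- x) = - ImZ x"
  "ReZ (x * y) = ReZ x * ReZ y - ImZ x * ImZ y"
  "ImZ (x * y) = ReZ x * ImZ y + ImZ x * ReZ y"
  by (simp_all add: zero_gauss_int_def one_gauss_int_def plus_gauss_int_def
      minus_gauss_int_def uminus_gauss_int_def times_gauss_int_def)

instance
  by standard (auto simp: gauss_int_eq_iff algebra_simps)

end

definition gauss_i :: gauss_int where
  "gauss_i = Gauss 0 1"

definition gauss_norm :: "gauss_int \<Rightarrow> int" where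
  "gauss_norm x = ReZ x ^ 2 + ImZ x ^ 2"

definition gauss_cnj :: "gauss_int \<Rightarrow> gauss_int" where
  "gauss_cnj x = Gauss (ReZ x) (- ImZ x)"

lemma gauss_cnj_sel [simp]: "ReZ (gauss_cnj x) = ReZ x" "ImZ (gauss_cnj x) = - ImZ x"
  by (simp_all add: gauss_cnj_def)

lemma gauss_norm_nonneg [simp]: "gauss_norm x \<ge> 0"
  by (simp add: gauss_norm_def)

lemma gauss_norm_eq_0_iff [simp]: "gauss_norm x = 0 \<longleftrightarrow> x = 0"
  by (simp add: gauss_norm_def gauss_int_eq_iff sum_power2_eq_zero_iff)

lemma gauss_norm_pos_iff [simp]: "gauss_norm x > 0 \<longleftrightarrow> x \<noteq> 0"
  using gauss_norm_nonneg[of x] gauss_norm_eq_0_iff[of x] by linarith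

lemma gauss_norm_one [simp]: "gauss_norm 1 = 1"
  by (simp add: gauss_norm_def)

lemma gauss_norm_mult: "gauss_norm (x * y) = gauss_norm x * gauss_norm y"
  by (simp add: gauss_norm_def power2_eq_square algebra_simps)

lemma gauss_norm_cnj [simp]: "gauss_norm (gauss_cnj x) = gauss_norm x"
  by (simp add: gauss_norm_def)

instance gauss_int :: idom
proof
  fix x y :: gauss_int
  assume "x \<noteq> 0" "y \<noteq> 0"
  then have "gauss_norm (x * y) \<noteq> 0"
    by (simp only: gauss_norm_mult) simp
  then show "x * y \<noteq> 0" by simp
qed

text \<open>
  The library's \<^const>\<open>coprime\<close> requires a type with a chosen division operation. The one below
  rounds both coordinates of the exact quotient to a nearest integer, which makes the Gaussian
  integers a Euclidean ring. Neither \<^const>\<open>coprime\<close> nor \<^const>\<open>prime_elem\<close> depends on this choice.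
\<close>

definition round_div :: "int \<Rightarrow> int \<Rightarrow> int" where
  "round_div a n = (2 * a + n) div (2 * n)"

lemma round_div_mult_self: "n > 0 \<Longrightarrow> round_div (a * n) n = a"
proof -
  assume n: "n > 0"
  have "round_div (a * n) n = (n + a * (2 * n)) div (2 * n)"
    by (simp add: round_div_def algebra_simps)
  also have "\<dots> = a + n div (2 * n)"
    using n by (intro div_mult_self1) simp
  also have "n div (2 * n) = 0" using n by (intro div_pos_pos_trivial) auto
  finally show ?thesis by simp
qed

lemma round_div_bound:
  assumes "n > 0"
  shows "2 * \<bar>a - round_div a n * n\<bar> \<le> n"
proof -
  have "2 * a + n = 2 * n * round_div a n + (2 * a + n) mod (2 * n)"
    by (simp add: round_div_def)
  moreover have "0 \<le> (2 * a + n) mod (2 * n)" "(2 * a + n) mod (2 * n) < 2 * n"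
    using assms by simp_all
  ultimately have "\<bar>2 * a - 2 * n * round_div a n\<bar> \<le> n" by linarith
  then show ?thesis by (simp add: abs_if algebra_simps split: if_splits)
qed

instantiation gauss_int :: idom_modulo
begin

definition divide_gauss_int :: "gauss_int \<Rightarrow> gauss_int \<Rightarrow> gauss_int" where
  "x div y = Gauss (round_div (ReZ (x * gauss_cnj y)) (gauss_norm y))
                   (round_div (ImZ (x * gauss_cnj y)) (gauss_norm y))"

definition modulo_gauss_int :: "gauss_int \<Rightarrow> gauss_int \<Rightarrow> gauss_int" where
  "x mod y = x - (x div y) * (y :: gauss_int)"

instance
proof
  fix a b :: gauss_int
  show "a * b div b = a" if "b \<noteq> 0"
  proof -
    have "ReZ (a * b * gauss_cnj b) = ReZ a * gauss_norm b"
         "ImZ (a * b * gauss_cnj b) = ImZ a * gauss_norm b"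
      by (simp_all add: gauss_norm_def power2_eq_square algebra_simps)
    with that show ?thesis
      by (simp only: divide_gauss_int_def) (simp add: round_div_mult_self)
  qed
  show "a div 0 = 0"
    by (simp add: divide_gauss_int_def gauss_norm_def round_div_def zero_gauss_int_def)
  show "a div b * b + a mod b = a"
    by (simp add: modulo_gauss_int_def)
qed

end

instantiation gauss_int :: euclidean_ring
begin

definition euclidean_size_gauss_int :: "gauss_int \<Rightarrow> nat" where
  "euclidean_size x = nat (gauss_norm x)"

instance
proof
  fix a b :: gauss_int
  show "euclidean_size (0 :: gauss_int) = 0"
    by (simp add: euclidean_size_gauss_int_def gauss_norm_def)
  show "euclidean_size (a mod b) < euclidean_size b" if "b \<noteq> 0"
  proof -
    define n where "n = gauss_norm b"
    define z where "z = a * gauss_cnj b"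
    define u where "u = ReZ z - round_div (ReZ z) n * n"
    define v where "v = ImZ z - round_div (ImZ z) n * n"
    have n: "n > 0" using that by (simp add: n_def)
    have "2 * \<bar>u\<bar> \<le> n" "2 * \<bar>v\<bar> \<le> n"
      unfolding u_def v_def by (intro round_div_bound n)+
    then have "(2 * u)\<^sup>2 \<le> n\<^sup>2" "(2 * v)\<^sup>2 \<le> n\<^sup>2"
      using n abs_le_square_iff[of "2 * u" n] abs_le_square_iff[of "2 * v" n]
      by (simp_all add: abs_mult)
    moreover have "n\<^sup>2 > 0" using n by simp
    ultimately have uv: "u\<^sup>2 + v\<^sup>2 < n\<^sup>2"
      unfolding power_mult_distrib power2_eq_square[of 2] by linarith
    have qn: "ReZ (w * b * gauss_cnj b) = ReZ w * n" "ImZ (w * b * gauss_cnj b) = ImZ w * n" for w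
      by (simp_all add: n_def gauss_norm_def power2_eq_square algebra_simps)
    have "a mod b * gauss_cnj b = z - (a div b) * b * gauss_cnj b"
      by (simp add: modulo_gauss_int_def z_def algebra_simps)
    moreover have "ReZ (a div b) = round_div (ReZ z) n" "ImZ (a div b) = round_div (ImZ z) n"
      by (simp_all only: divide_gauss_int_def z_def n_def gauss_int.sel)
    ultimately have "ReZ (a mod b * gauss_cnj b) = u" "ImZ (a mod b * gauss_cnj b) = v"
      by (simp_all only: gauss_int_sel(7,8) qn u_def v_def)
    then have "gauss_norm (a mod b * gauss_cnj b) = u\<^sup>2 + v\<^sup>2"
      by (simp only: gauss_norm_def)
    then have "gauss_norm (a mod b) * n < n * n"
      using uv by (simp add: gauss_norm_mult n_def power2_eq_square)
    then have "gauss_norm (a mod b) < n" using n by simp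
    then show ?thesis using that by (simp add: euclidean_size_gauss_int_def n_def)
  qed
  show "euclidean_size a \<le> euclidean_size (a * b)" if "b \<noteq> 0"
  proof -
    have "1 \<le> gauss_norm b" using that gauss_norm_pos_iff[of b] by linarith
    then have "gauss_norm a * 1 \<le> gauss_norm a * gauss_norm b"
      by (intro mult_left_mono) simp_all
    then show ?thesis by (simp add: euclidean_size_gauss_int_def gauss_norm_mult nat_mono)
  qed
qed

end

lemma is_unit_gauss_int_iff:
  fixes u :: gauss_int
  shows "is_unit u \<longleftrightarrow> u \<in> {1, - 1, gauss_i, - gauss_i}"
proof
  assume "is_unit u"
  then obtain v where "1 = u * v" by (elim dvdE)
  then have "gauss_norm u * gauss_norm v = 1"
    by (metis gauss_norm_mult gauss_norm_one)
  then have "gauss_norm u = 1"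
    using gauss_norm_nonneg[of u] by (simp add: zmult_eq_1_iff)
  then have eq: "ReZ u * ReZ u + ImZ u * ImZ u = 1"
    by (simp add: gauss_norm_def power2_eq_square)
  have sq: "\<bar>k\<bar> \<le> k * k" for k :: int
    using self_le_power[of "\<bar>k\<bar>" 2] by (cases "k = 0") (auto simp: power2_eq_square)
  have "\<bar>ReZ u\<bar> + \<bar>ImZ u\<bar> \<le> 1"
    using sq[of "ReZ u"] sq[of "ImZ u"] eq by linarith
  then have "ReZ u \<in> {-1, 0, 1} \<and> ImZ u \<in> {-1, 0, 1} \<and> (ReZ u = 0 \<or> ImZ u = 0)"
    by auto
  with eq show "u \<in> {1, - 1, gauss_i, - gauss_i}"
    by (auto simp: gauss_int_eq_iff gauss_i_def)
next
  have "gauss_i * (- gauss_i) = 1"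
    by (simp add: gauss_int_eq_iff gauss_i_def)
  then have "is_unit gauss_i" by (metis dvd_triv_left)
  then show "is_unit u" if "u \<in> {1, - 1, gauss_i, - gauss_i}"
    using that by auto
qed


section \<open>Prime support and the coprimality topology\<close>

definition gauss_associated :: "(gauss_int \<times> gauss_int) set" where
  "gauss_associated = {(\<alpha>, \<beta>). \<alpha> \<noteq> 0 \<and> \<beta> \<noteq> 0 \<and> (\<exists>u. is_unit u \<and> \<alpha> = u * \<beta>)}"

lemma equiv_gauss_associated: "equiv (- {0}) gauss_associated"
proof (rule equivI)
  show "gauss_associated \<subseteq> (- {0}) \<times> (- {0})"
    by (auto simp: gauss_associated_def)
  have "\<exists>u. is_unit u \<and> \<alpha> = u * \<alpha>" for \<alpha> :: gauss_int
    by (rule exI[of _ 1]) simp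
  then show "refl_on (- {0}) gauss_associated"
    unfolding refl_on_def gauss_associated_def by simp
  show "sym gauss_associated"
  proof (rule symI)
    fix \<alpha> \<beta> assume "(\<alpha>, \<beta>) \<in> gauss_associated"
    then obtain u where u: "is_unit u" "\<alpha> = u * \<beta>" "\<alpha> \<noteq> 0" "\<beta> \<noteq> 0"
      unfolding gauss_associated_def by blast
    from u(1) obtain v where v: "1 = u * v" by (elim dvdE)
    then have "is_unit v" by (metis dvd_triv_right)
    moreover have "\<beta> = v * \<alpha>"
      using u(2) v by (metis mult.assoc mult.commute mult.left_neutral)
    ultimately show "(\<beta>, \<alpha>) \<in> gauss_associated"
      using u(3,4) unfolding gauss_associated_def by blast
  qed
  show "trans gauss_associated"
  proof (rule transI)
    fix \<alpha> \<beta> \<gamma> assume "(\<alpha>, \<beta>) \<in> gauss_associated" "(\<beta>, \<gamma>) \<in> gauss_associated"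
    then obtain u v where "is_unit u" "\<alpha> = u * \<beta>" "is_unit v" "\<beta> = v * \<gamma>" "\<alpha> \<noteq> 0" "\<gamma> \<noteq> 0"
      unfolding gauss_associated_def by blast
    moreover from this have "is_unit (u * v)" "\<alpha> = (u * v) * \<gamma>"
      by (simp_all add: mult.assoc is_unit_mult_iff)
    ultimately show "(\<alpha>, \<gamma>) \<in> gauss_associated"
      unfolding gauss_associated_def by blast
  qed
qed

definition Supp :: "gauss_int \<Rightarrow> gauss_int set set" where
  "Supp \<alpha> = {p. prime_elem p \<and> p dvd \<alpha>} // gauss_associated"

definition coprime_to :: "gauss_int \<Rightarrow> gauss_int set" where
  "coprime_to \<alpha> = {\<beta>. \<beta> \<noteq> 0 \<and> coprime \<alpha> \<beta>}"

definition coprimality_topology :: "gauss_int topology" where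
  "coprimality_topology = topology_generated_by {coprime_to \<alpha> | \<alpha>. \<alpha> \<noteq> 0}"

lemma topspace_coprimality_topology: "topspace coprimality_topology = - {0}"
proof -
  have "coprime_to 1 = - {0}" by (auto simp: coprime_to_def)
  moreover have "coprime_to \<alpha> \<subseteq> - {0}" for \<alpha> by (auto simp: coprime_to_def)
  ultimately have "\<Union>{coprime_to \<alpha> | \<alpha>. \<alpha> \<noteq> 0} = - {0}"
    by (intro equalityI Union_least subsetI UnionI[of "coprime_to 1"]) auto
  then show ?thesis
    by (simp only: coprimality_topology_def topology_generated_by_topspace)
qed

definition topologically_indistinguishable :: "'a topology \<Rightarrow> 'a \<Rightarrow> 'a \<Rightarrow> bool" where
  "topologically_indistinguishable X x y \<longleftrightarrow>
     x \<in> topspace X \<and> y \<in> topspace X \<and> (\<forall>U. openin X U \<longrightarrow> (x \<in> U \<longleftrightarrow> y \<in> U))"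

end

theory Submission
  imports Defs
begin

text \<open>
  Membership in all members of a subbase decides membership in all open sets, so \<open>x\<close> and \<open>y\<close> are
  indistinguishable iff every nonzero \<open>\<alpha>\<close> is coprime to both of them or to neither
  (\<open>topologically_indistinguishable_generated_iff\<close>). This happens exactly when \<open>x\<close> and \<open>y\<close> have
  the same prime divisors. If they do, then every \<open>\<alpha>\<close> treats them alike, because coprimality means
  the absence of a common prime divisor (\<open>coprime_iff_no_common_prime\<close>). Conversely, a prime \<open>\<alpha>\<close>
  is coprime to an element iff it fails to divide it, so the sets \<open>coprime_to \<alpha>\<close> with \<open>\<alpha>\<close> prime
  already detect every prime divisor (\<open>coprime_prime_elem_iff\<close>). Finally, divisibility by a prime
  depends only on its associate class, so equality of the supports is equality of the sets of prime
  divisors (\<open>Supp_eq_iff\<close>).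

  The one arithmetic input is that every nonzero nonunit has a prime divisor. It follows from
  division with remainder (\<open>euclidean_ring_prime_divisor_exists\<close>).
\<close>

text \<open>
  A nonzero combination of \<open>a\<close> and \<open>b\<close> of least Euclidean size divides both: the remainder of
  either one on division by it is again a combination, of smaller size, hence zero.
\<close>

lemma euclidean_ring_bezout:
  fixes a b :: "'a :: euclidean_ring"
  assumes "a \<noteq> 0"
  obtains r s where "r * a + s * b dvd a" "r * a + s * b dvd b"
proof -
  define I where "I = {r * a + s * b | r s. True}"
  have comb: "r * a + s * b \<in> I" for r s by (auto simp: I_def)
  have a: "a \<in> I" and b: "b \<in> I" using comb[of 1 0] comb[of 0 1] by simp_all
  obtain g where g: "g \<in> I" "g \<noteq> 0"
    and least: "\<And>h. h \<in> I \<Longrightarrow> h \<noteq> 0 \<Longrightarrow> euclidean_size g \<le> euclidean_size h"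
    using ex_has_least_nat[of "\<lambda>h. h \<in> I \<and> h \<noteq> 0" a euclidean_size] a assms by auto
  obtain r s where rs: "g = r * a + s * b" using g(1) by (auto simp: I_def)
  have "g dvd h" if "h \<in> I" for h
  proof -
    obtain r' s' where h: "h = r' * a + s' * b" using \<open>h \<in> I\<close> by (auto simp: I_def)
    define q where "q = h div g"
    have "h mod g = h - q * g" by (simp add: q_def minus_div_mult_eq_mod)
    also have "\<dots> = (r' - q * r) * a + (s' - q * s) * b"
      by (simp add: h rs algebra_simps)
    finally have "h mod g \<in> I" using comb by simp
    then have "h mod g = 0" using least mod_size_less[OF g(2), of h] not_le by blast
    then show ?thesis by (simp add: dvd_eq_mod_eq_0)
  qed
  then show thesis using that rs a b by blast
qed

text \<open>
  A nonunit divisor \<open>d\<close> of \<open>c\<close> of least Euclidean size is prime. If \<open>d\<close> does not divide \<open>a\<close>, then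
  a greatest common divisor of \<open>d\<close> and \<open>a\<close> is a unit, since otherwise minimality would make it an
  associate of \<open>d\<close>, and \<open>d\<close> would divide \<open>a\<close>. So \<open>d\<close> and \<open>a\<close> generate the unit ideal, and \<open>d dvd a * b\<close> yields \<open>d dvd b\<close>.
\<close>

lemma euclidean_ring_prime_divisor_exists:
  fixes c :: "'a :: euclidean_ring"
  assumes "c \<noteq> 0" "\<not> is_unit c"
  obtains p where "prime_elem p" "p dvd c"
proof -
  obtain d where d: "d dvd c" "\<not> is_unit d"
    and least: "\<And>e. e dvd c \<Longrightarrow> \<not> is_unit e \<Longrightarrow> euclidean_size d \<le> euclidean_size e"
    using ex_has_least_nat[of "\<lambda>e. e dvd c \<and> \<not> is_unit e" c euclidean_size] assms by auto
  have d0: "d \<noteq> 0" using assms d by auto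
  have "prime_elem d"
  proof (rule prime_elemI[OF d0 d(2)])
    fix a b assume ab: "d dvd a * b"
    obtain r s where g: "r * d + s * a dvd d" "r * d + s * a dvd a"
      using euclidean_ring_bezout[OF d0] by blast
    show "d dvd a \<or> d dvd b"
    proof (cases "is_unit (r * d + s * a)")
      case True
      have "(r * d + s * a) * b = d * (r * b) + s * (a * b)" by (simp add: algebra_simps)
      then have "d dvd (r * d + s * a) * b" using ab by simp
      then show ?thesis using True by (simp add: dvd_mult_unit_iff')
    next
      case False
      have "euclidean_size d \<le> euclidean_size (r * d + s * a)"
        using least False g(1) d(1) dvd_trans by blast
      moreover have "euclidean_size (r * d + s * a) \<le> euclidean_size d"
        using g(1) d0 by (rule dvd_imp_size_le)
      ultimately have "d dvd r * d + s * a"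
        using dvd_euclidean_size_eq_imp_dvd[OF d0 _ g(1)] by simp
      then show ?thesis using g(2) dvd_trans by blast
    qed
  qed
  then show thesis using that d(1) by blast
qed

lemma coprime_iff_no_common_prime:
  fixes a b :: "'a :: euclidean_ring"
  assumes "a \<noteq> 0"
  shows "coprime a b \<longleftrightarrow> (\<nexists>p. prime_elem p \<and> p dvd a \<and> p dvd b)"
proof
  show "\<nexists>p. prime_elem p \<and> p dvd a \<and> p dvd b" if "coprime a b"
    using that coprime_common_divisor prime_elem_not_unit by blast
  show "coprime a b" if none: "\<nexists>p. prime_elem p \<and> p dvd a \<and> p dvd b"
  proof (rule coprimeI, rule ccontr)
    fix c assume c: "c dvd a" "c dvd b" "\<not> is_unit c"
    moreover have "c \<noteq> 0" using c(1) assms by auto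
    ultimately show False
      using none euclidean_ring_prime_divisor_exists dvd_trans by metis
  qed
qed

text \<open>
  Primality makes \<open>p\<close> irreducible, so a common divisor of \<open>p\<close> and \<open>a\<close> is a unit or an associate of
  \<open>p\<close>, and the latter forces \<open>p dvd a\<close>.
\<close>

lemma coprime_prime_elem_iff:
  fixes p a :: "'a :: algebraic_semidom"
  assumes "prime_elem p"
  shows "coprime p a \<longleftrightarrow> \<not> p dvd a"
proof
  show "\<not> p dvd a" if "coprime p a"
    using that prime_elem_not_unit[OF assms] coprime_absorb_left[of p a] by auto
  show "coprime p a" if "\<not> p dvd a"
  proof (rule coprimeI)
    fix c assume "c dvd p" "c dvd a"
    then have "\<not> p dvd c" using that dvd_trans[of p c a] by auto
    then show "is_unit c"
      using irreducibleD'[OF prime_elem_imp_irreducible[OF assms] \<open>c dvd p\<close>] by simp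
  qed
qed

lemma Supp_subset_iff:
  "Supp x \<subseteq> Supp y \<longleftrightarrow> (\<forall>p. prime_elem p \<longrightarrow> p dvd x \<longrightarrow> p dvd y)"
proof
  show "Supp x \<subseteq> Supp y" if "\<forall>p. prime_elem p \<longrightarrow> p dvd x \<longrightarrow> p dvd y"
    using that by (auto simp: Supp_def quotient_def)
  show "\<forall>p. prime_elem p \<longrightarrow> p dvd x \<longrightarrow> p dvd y" if sub: "Supp x \<subseteq> Supp y"
  proof (intro allI impI)
    fix p assume p: "prime_elem p" "p dvd x"
    have "gauss_associated `` {p} \<in> Supp y"
      using sub p unfolding Supp_def quotient_def by blast
    then obtain q where q: "prime_elem q" "q dvd y"
      and eq: "gauss_associated `` {p} = gauss_associated `` {q}"
      unfolding Supp_def quotient_def by blast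
    have "(p, q) \<in> gauss_associated"
      using eq_equiv_class[OF eq equiv_gauss_associated] q(1) by auto
    then obtain u where "is_unit u" "p = u * q" by (auto simp: gauss_associated_def)
    then show "p dvd y" using q(2) by (simp add: mult_unit_dvd_iff')
  qed
qed

lemma Supp_eq_iff: "Supp x = Supp y \<longleftrightarrow> (\<forall>p. prime_elem p \<longrightarrow> p dvd x \<longleftrightarrow> p dvd y)"
  using Supp_subset_iff[of x y] Supp_subset_iff[of y x] by auto

text \<open>
  The sets that contain both or neither of two points are closed under unions and finite
  intersections. If they include a subbase, they therefore include all open sets.
\<close>

lemma topologically_indistinguishable_generated_iff:
  "topologically_indistinguishable (topology_generated_by S) x y \<longleftrightarrow>
     x \<in> \<Union>S \<and> y \<in> \<Union>S \<and> (\<forall>U\<in>S. x \<in> U \<longleftrightarrow> y \<in> U)"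
proof -
  have "x \<in> U \<longleftrightarrow> y \<in> U"
    if sub: "\<forall>U\<in>S. x \<in> U \<longleftrightarrow> y \<in> U" and U: "generate_topology_on S U" for U
    using U by induction (use sub in auto)
  then show ?thesis
    unfolding topologically_indistinguishable_def topology_generated_by_topspace
      openin_topology_generated_by_iff
    by (meson generate_topology_on.Basis)
qed

lemma coprimality_indistinguishable_iff:
  assumes "x \<noteq> 0" "y \<noteq> 0"
  shows "topologically_indistinguishable coprimality_topology x y \<longleftrightarrow>
    (\<forall>\<alpha>. \<alpha> \<noteq> 0 \<longrightarrow> coprime \<alpha> x \<longleftrightarrow> coprime \<alpha> y)"
proof -
  have "\<Union>{coprime_to \<alpha> |\<alpha>. \<alpha> \<noteq> 0} = - {0}"
    using topspace_coprimality_topology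
    unfolding coprimality_topology_def topology_generated_by_topspace .
  then show ?thesis
    unfolding coprimality_topology_def topologically_indistinguishable_generated_iff
    using assms by (auto simp: coprime_to_def)
qed

theorem theorem3p2:
  fixes x y :: gauss_int
  assumes "x \<noteq> 0" and "y \<noteq> 0"
  shows "topologically_indistinguishable coprimality_topology x y \<longleftrightarrow> Supp x = Supp y"
proof -
  have "(\<forall>\<alpha>. \<alpha> \<noteq> 0 \<longrightarrow> coprime \<alpha> x \<longleftrightarrow> coprime \<alpha> y) \<longleftrightarrow>
      (\<forall>p. prime_elem p \<longrightarrow> p dvd x \<longleftrightarrow> p dvd y)" (is "?coprime \<longleftrightarrow> ?primes")
  proof
    show ?primes if ?coprime
    proof (intro allI impI)
      fix p :: gauss_int assume p: "prime_elem p"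
      then have "coprime p x \<longleftrightarrow> coprime p y"
        using that prime_elem_not_zeroI by blast
      then show "p dvd x \<longleftrightarrow> p dvd y" by (simp add: coprime_prime_elem_iff[OF p])
    qed
    show ?coprime if ?primes
    proof (intro allI impI)
      fix \<alpha> :: gauss_int assume "\<alpha> \<noteq> 0"
      then show "coprime \<alpha> x \<longleftrightarrow> coprime \<alpha> y"
        using that by (auto simp: coprime_iff_no_common_prime)
    qed
  qed
  then show ?thesis
    unfolding coprimality_indistinguishable_iff[OF assms] Supp_eq_iff .
qed

end
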